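(* Let $M$ be a matroid and let $c$ be the size of a largest circuit of $M$, with $c=1$ if $M$ has no circuits. Then $\log_2 c\le\mathrm{cd}(M)\le c(c+1)/2$.
   Context: Contraction depth $\mathrm{cd}$ of a matroid $M$ is defined recursively: $\mathrm{cd}(M)=0$ if $E(M)=\emptyset$; if $M$ is disconnected, $\mathrm{cd}(M)$ is the maximum contraction depth of its connected components; if $M$ is connected and $E(M)\ne\emptyset$, $\mathrm{cd}(M)$ is the minimum $k$ such that $\mathrm{cd}(M/e)\le k-1$ for some $e\in E(M)$. *)

theory Defs
  imports Complex_Main
begin

definition is_matroid :: "'a set \<Rightarrow> 'a set set \<Rightarrow> bool" where
  "is_matroid E F \<longleftrightarrow>
     finite E \<and>
     (\<forall>I\<in>F. I \<subseteq> E) \<and>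
     {} \<in> F \<and>
     (\<forall>I J. I \<in> F \<longrightarrow> J \<subseteq> I \<longrightarrow> J \<in> F) \<and>
     (\<forall>I J. I \<in> F \<longrightarrow> J \<in> F \<longrightarrow> card I < card J \<longrightarrow> (\<exists>x\<in>J - I. insert x I \<in> F))"

typedef 'a matroid = "{(E :: 'a set, F :: 'a set set). is_matroid E F}"
  morphisms matroid_pair Abs_matroid
proof
  show "({}, {{}}) \<in> {(E :: 'a set, F :: 'a set set). is_matroid E F}"
    by (auto simp: is_matroid_def)
qed

definition ground :: "'a matroid \<Rightarrow> 'a set" where
  "ground M = fst (matroid_pair M)"

definition indep :: "'a matroid \<Rightarrow> 'a set \<Rightarrow> bool" where
  "indep M I \<longleftrightarrow> I \<in> snd (matroid_pair M)"

lemma is_matroid_ground_indep: "is_matroid (ground M) {I. indep M I}"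
  using matroid_pair[of M] by (simp add: ground_def indep_def case_prod_beta)

lemma finite_ground [simp]: "finite (ground M)"
  using is_matroid_ground_indep[of M] by (simp add: is_matroid_def)

lemma indep_subset_ground: "indep M I \<Longrightarrow> I \<subseteq> ground M"
  using is_matroid_ground_indep[of M] by (simp add: is_matroid_def)

lemma indep_finite: "indep M I \<Longrightarrow> finite I"
  by (rule finite_subset[OF indep_subset_ground finite_ground])

lemma indep_empty [simp]: "indep M {}"
  using is_matroid_ground_indep[of M] by (simp add: is_matroid_def)

lemma indep_mono: "indep M I \<Longrightarrow> J \<subseteq> I \<Longrightarrow> indep M J"
  using is_matroid_ground_indep[of M] by (simp add: is_matroid_def)

lemma indep_augment:
  "indep M I \<Longrightarrow> indep M J \<Longrightarrow> card I < card J \<Longrightarrow> \<exists>x\<in>J - I. indep M (insert x I)"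
  using is_matroid_ground_indep[of M] by (simp add: is_matroid_def)

lemma ground_Abs_matroid: "is_matroid E F \<Longrightarrow> ground (Abs_matroid (E, F)) = E"
  by (simp add: ground_def Abs_matroid_inverse)

lemma indep_Abs_matroid: "is_matroid E F \<Longrightarrow> indep (Abs_matroid (E, F)) I \<longleftrightarrow> I \<in> F"
  by (simp add: indep_def Abs_matroid_inverse)

definition circuit :: "'a matroid \<Rightarrow> 'a set \<Rightarrow> bool" where
  "circuit M C \<longleftrightarrow> C \<subseteq> ground M \<and> \<not> indep M C \<and> (\<forall>D. D \<subset> C \<longrightarrow> indep M D)"

definition restriction :: "'a matroid \<Rightarrow> 'a set \<Rightarrow> 'a matroid" where
  "restriction M X = Abs_matroid (ground M \<inter> X, {I. indep M I \<and> I \<subseteq> X})"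

lemma is_matroid_restriction: "is_matroid (ground M \<inter> X) {I. indep M I \<and> I \<subseteq> X}"
  unfolding is_matroid_def
proof (intro conjI allI ballI impI)
  fix I J assume "I \<in> {I. indep M I \<and> I \<subseteq> X}" "J \<in> {I. indep M I \<and> I \<subseteq> X}" "card I < card J"
  with indep_augment[of M I J] show "\<exists>x\<in>J - I. insert x I \<in> {I. indep M I \<and> I \<subseteq> X}"
    by auto
next
  fix I J assume "I \<in> {I. indep M I \<and> I \<subseteq> X}" "J \<subseteq> I"
  then show "J \<in> {I. indep M I \<and> I \<subseteq> X}"
    using indep_mono[of M I J] by auto
qed (auto dest: indep_subset_ground)

lemma ground_restriction [simp]: "ground (restriction M X) = ground M \<inter> X"
  by (simp add: restriction_def ground_Abs_matroid is_matroid_restriction)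

lemma indep_restriction [simp]: "indep (restriction M X) I \<longleftrightarrow> indep M I \<and> I \<subseteq> X"
  by (simp add: restriction_def indep_Abs_matroid is_matroid_restriction)

text \<open>Contracting a loop amounts to deleting it.\<close>

definition contract :: "'a matroid \<Rightarrow> 'a \<Rightarrow> 'a matroid" where
  "contract M e = Abs_matroid (ground M - {e},
     {I. I \<subseteq> ground M - {e} \<and> (if indep M {e} then indep M (insert e I) else indep M I)})"

lemma is_matroid_contract:
  "is_matroid (ground M - {e})
     {I. I \<subseteq> ground M - {e} \<and> (if indep M {e} then indep M (insert e I) else indep M I)}"
  (is "is_matroid _ ?F")
  unfolding is_matroid_def
proof (intro conjI allI ballI impI)
  fix I J assume "I \<in> ?F" "J \<in> ?F" and less: "card I < card J"
  then have I: "I \<subseteq> ground M - {e}" "if indep M {e} then indep M (insert e I) else indep M I"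
    and J: "J \<subseteq> ground M - {e}" "if indep M {e} then indep M (insert e J) else indep M J"
    by simp_all
  have fin: "finite I" "finite J" and e: "e \<notin> I" "e \<notin> J"
    using I(1) J(1) finite_subset[OF _ finite_ground[of M]] by blast+
  show "\<exists>x\<in>J - I. insert x I \<in> ?F"
  proof (cases "indep M {e}")
    case True
    have "card (insert e I) < card (insert e J)"
      using less fin e by simp
    moreover have "indep M (insert e I)" "indep M (insert e J)"
      using I(2) J(2) True by simp_all
    ultimately obtain x where x: "x \<in> insert e J - insert e I" "indep M (insert x (insert e I))"
      using indep_augment by blast
    have "x \<in> J - I" "insert x I \<subseteq> ground M - {e}"
      using x(1) I(1) J(1) by blast+
    then show ?thesis
      using x(2) True by (intro bexI[of _ x]) (simp_all add: insert_commute)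
  next
    case False
    then obtain x where x: "x \<in> J - I" "indep M (insert x I)"
      using indep_augment[OF _ _ less] I(2) J(2) by auto
    have "insert x I \<subseteq> ground M - {e}"
      using x(1) I(1) J(1) by blast
    then show ?thesis
      using x False by (intro bexI[of _ x]) simp_all
  qed
next
  fix I J assume I: "I \<in> ?F" and "J \<subseteq> I"
  then have "J \<subseteq> ground M - {e}" "insert e J \<subseteq> insert e I"
    by blast+
  then show "J \<in> ?F"
    using I \<open>J \<subseteq> I\<close> by (cases "indep M {e}") (simp_all add: indep_mono[of M I J] indep_mono[of M "insert e I" "insert e J"])
next
  fix I assume "I \<in> ?F"
  then show "I \<subseteq> ground M - {e}"
    by simp
qed simp_all

lemma ground_contract [simp]: "ground (contract M e) = ground M - {e}"
  by (simp add: contract_def ground_Abs_matroid is_matroid_contract)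

lemma indep_contract:
  "indep (contract M e) I \<longleftrightarrow>
     I \<subseteq> ground M - {e} \<and> (if indep M {e} then indep M (insert e I) else indep M I)"
  by (simp add: contract_def indep_Abs_matroid is_matroid_contract)

definition connected_matroid :: "'a matroid \<Rightarrow> bool" where
  "connected_matroid M \<longleftrightarrow>
     (\<forall>x\<in>ground M. \<forall>y\<in>ground M. x \<noteq> y \<longrightarrow> (\<exists>C. circuit M C \<and> x \<in> C \<and> y \<in> C))"

text \<open>
  The connected components are the inclusion-wise maximal nonempty connected restrictions,
  represented by their ground sets.
\<close>

definition components_matroid :: "'a matroid \<Rightarrow> 'a set set" where
  "components_matroid M =
     {X. X \<subseteq> ground M \<and> X \<noteq> {} \<and> connected_matroid (restriction M X) \<and>
         (\<forall>Y. X \<subseteq> Y \<longrightarrow> Y \<subseteq> ground M \<longrightarrow> connected_matroid (restriction M Y) \<longrightarrow> Y = X)}"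

lemma restriction_ground [simp]: "restriction M (ground M) = M"
proof -
  have "(ground M, {I. indep M I \<and> I \<subseteq> ground M}) = matroid_pair M"
    using indep_subset_ground[of M] by (auto simp: ground_def indep_def prod_eq_iff)
  then show ?thesis
    by (simp add: restriction_def matroid_pair_inverse)
qed

text \<open>
  The bound is written \<open>cd (contract M e) + 1 \<le> k\<close> because truncated subtraction would let
  \<open>k = 0\<close> satisfy \<open>cd (contract M e) \<le> k - 1\<close>.
\<close>

function cd :: "'a matroid \<Rightarrow> nat" where
  "cd M =
     (if ground M = {} then 0
      else if \<not> connected_matroid M then
        Max ((\<lambda>X. cd (restriction M X)) ` components_matroid M)
      else (LEAST k. \<exists>e\<in>ground M. cd (contract M e) + 1 \<le> k))"
  by pat_completeness auto
termination
proof (relation "measure (\<lambda>M. card (ground M))")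
  fix M :: "'a matroid" and X
  assume "\<not> connected_matroid M" "X \<in> components_matroid M"
  then have "X \<subset> ground M"
    unfolding components_matroid_def by auto
  then show "(restriction M X, M) \<in> measure (\<lambda>M. card (ground M))"
    by (simp add: psubset_card_mono Int_absorb1)
next
  fix M :: "'a matroid" and e
  assume "e \<in> ground M"
  then show "(contract M e, M) \<in> measure (\<lambda>M. card (ground M))"
    using card_Diff1_less[OF finite_ground] by (simp only: in_measure ground_contract)
qed simp

declare cd.simps [simp del]

definition max_circuit_size :: "'a matroid \<Rightarrow> nat" where
  "max_circuit_size M =
     (if \<exists>C. circuit M C then Max (card ` {C. circuit M C}) else 1)"

lemma finite_circuits: "finite {C. circuit M C}"
  by (rule finite_subset[of _ "Pow (ground M)"]) (auto simp: circuit_def)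

end

theory Submission imports Defs
begin

text \<open>
  Lower bound: contracting an element \<open>e\<close> either shortens a circuit \<open>C\<close> by one or writes it as a
  union of two circuits of \<open>M / e\<close>, so the largest circuit loses at most half of its size.

  Upper bound: in a connected matroid with largest circuit \<open>C\<close>, every circuit of \<open>M / C\<close> is smaller
  than \<open>C\<close>. Otherwise some circuit \<open>C'\<close> of \<open>M\<close>, disjoint from \<open>C\<close> and of the same size, is a circuit
  of \<open>M / C\<close>. Take a circuit \<open>D\<close> meeting both with \<open>Z = D - (C \<union> C')\<close> minimal; \<open>Z\<close> is nonempty, and
  exchanging \<open>D \<inter> C\<close> for \<open>C - D\<close> and \<open>D \<inter> C'\<close> for \<open>C' - D\<close> yields a second circuit containing
  \<open>Z\<close>. The two sizes add up to more than \<open>2 |C|\<close>, a contradiction. Contracting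
  the elements of \<open>C\<close> one by one gives \<open>c + (c - 1) + \<dots> + 1\<close>.
\<close>

section \<open>Circuits\<close>

lemma matroid_eqI:
  assumes "ground M = ground N" "\<And>I. indep M I \<longleftrightarrow> indep N I"
  shows "M = N"
proof -
  have "snd (matroid_pair M) = snd (matroid_pair N)"
    using assms(2) by (auto simp: indep_def)
  then have "matroid_pair M = matroid_pair N"
    using assms(1) by (simp add: ground_def prod_eq_iff)
  then show ?thesis
    by (simp add: matroid_pair_inject)
qed

lemma circuit_subset_ground: "circuit M C \<Longrightarrow> C \<subseteq> ground M"
  by (simp add: circuit_def)

lemma circuit_finite: "circuit M C \<Longrightarrow> finite C"
  using circuit_subset_ground finite_ground finite_subset by metis

lemma circuit_nonempty: "circuit M C \<Longrightarrow> C \<noteq> {}"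
  by (auto simp: circuit_def)

lemma circuit_dependent: "circuit M C \<Longrightarrow> \<not> indep M C"
  by (simp add: circuit_def)

lemma circuit_psubset_indep: "circuit M C \<Longrightarrow> D \<subset> C \<Longrightarrow> indep M D"
  by (simp add: circuit_def)

lemma circuit_subset_eq: "circuit M C \<Longrightarrow> circuit M D \<Longrightarrow> C \<subseteq> D \<Longrightarrow> C = D"
  by (auto simp: circuit_def)

lemma dependent_contains_circuit:
  assumes "S \<subseteq> ground M" "\<not> indep M S"
  obtains C where "circuit M C" "C \<subseteq> S"
proof -
  have "finite S"
    using assms(1) finite_ground by (rule finite_subset)
  then have "\<exists>C. circuit M C \<and> C \<subseteq> S"
    using assms
  proof (induction S rule: finite_psubset_induct)
    case (psubset S)
    show ?case
    proof (cases "\<forall>D. D \<subset> S \<longrightarrow> indep M D")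
      case True
      then show ?thesis
        using psubset.prems by (auto simp: circuit_def)
    next
      case False
      then obtain D where D: "D \<subset> S" "\<not> indep M D"
        by blast
      then obtain C where "circuit M C" "C \<subseteq> D"
        using psubset.IH[of D] psubset.prems by blast
      then show ?thesis
        using D by blast
    qed
  qed
  then show thesis
    using that by blast
qed

lemma dependent_insert_circuit:
  assumes "indep M B" "\<not> indep M (insert f B)" "f \<in> ground M"
  obtains C where "circuit M C" "f \<in> C" "C \<subseteq> insert f B"
proof -
  have "insert f B \<subseteq> ground M"
    using assms indep_subset_ground by blast
  then obtain C where C: "circuit M C" "C \<subseteq> insert f B"
    using assms dependent_contains_circuit by metis
  moreover have "f \<in> C"
    using C assms(1) circuit_dependent indep_mono by (metis subset_insert)
  ultimately show thesis
    using that by blast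
qed

section \<open>Maximal independent subsets and strong circuit elimination\<close>

definition basis_of :: "'a matroid \<Rightarrow> 'a set \<Rightarrow> 'a set \<Rightarrow> bool" where
  "basis_of M X B \<longleftrightarrow> B \<subseteq> X \<and> indep M B \<and> (\<forall>x\<in>X - B. \<not> indep M (insert x B))"

lemma basis_of_exists:
  assumes "indep M J" "J \<subseteq> X"
  obtains B where "basis_of M X B" "J \<subseteq> B"
proof -
  define A where "A = {I. indep M I \<and> I \<subseteq> X \<and> J \<subseteq> I}"
  have "A \<subseteq> Pow (ground M)"
    using indep_subset_ground by (auto simp: A_def)
  then have "finite A"
    by (rule finite_subset) simp
  moreover have "J \<in> A"
    using assms by (simp add: A_def)
  ultimately obtain B where B: "B \<in> A" "\<forall>I\<in>A. B \<subseteq> I \<longrightarrow> B = I"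
    using finite_has_maximal2 by metis
  have "\<not> indep M (insert x B)" if x: "x \<in> X - B" for x
  proof
    assume "indep M (insert x B)"
    then have "insert x B \<in> A"
      using x B(1) by (auto simp: A_def)
    then show False
      using B(2) x by blast
  qed
  then have "basis_of M X B"
    using B(1) by (simp add: basis_of_def A_def)
  then show thesis
    using that B(1) by (simp add: A_def)
qed

lemma basis_of_card_ge:
  assumes "basis_of M X B" "indep M J" "J \<subseteq> X"
  shows "card J \<le> card B"
  using assms indep_augment[of M B J] unfolding basis_of_def by (meson DiffD1 DiffD2 DiffI linorder_not_less subsetD)

text \<open>Extend \<open>C - {e}\<close> to a basis \<open>B'\<close> of \<open>X\<close>. If
  \<open>insert e B\<close> were independent, it would augment \<open>B'\<close>: by
  \<open>e\<close>, making \<open>C\<close> independent, or by an element of \<open>X\<close>,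
  against the maximality of \<open>B'\<close>.\<close>

lemma basis_of_insert_dependent:
  assumes B: "basis_of M X B" and C: "circuit M C" "e \<in> C" "C - {e} \<subseteq> X" and e: "e \<notin> X"
  shows "\<not> indep M (insert e B)"
proof
  assume ind: "indep M (insert e B)"
  have "indep M (C - {e})"
    using C by (intro circuit_psubset_indep[OF C(1)]) auto
  then obtain B' where B': "basis_of M X B'" "C - {e} \<subseteq> B'"
    using C(3) basis_of_exists by metis
  have "e \<notin> B" "finite B"
    using B e indep_finite by (auto simp: basis_of_def)
  moreover have "card B' \<le> card B"
    using B B' by (intro basis_of_card_ge[OF B]) (auto simp: basis_of_def)
  ultimately have "card B' < card (insert e B)"
    by simp
  then obtain x where x: "x \<in> insert e B - B'" "indep M (insert x B')"
    using indep_augment[OF _ ind] B'(1) unfolding basis_of_def by metis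
  show False
  proof (cases "x = e")
    case True
    then have "indep M C"
      using x(2) B'(2) by (intro indep_mono[OF x(2)]) auto
    then show False
      using C(1) circuit_dependent by blast
  next
    case False
    then show False
      using x B B'(1) by (auto simp: basis_of_def)
  qed
qed

text \<open>A basis \<open>B\<close> of the union without \<open>e\<close> and \<open>f\<close>
  spans \<open>e\<close> through \<open>C2\<close>, and then \<open>f\<close> through
  \<open>C1\<close>. So \<open>insert f B\<close>, which avoids \<open>e\<close>, contains a circuit
  through \<open>f\<close>.\<close>

lemma strong_circuit_elimination:
  assumes C: "circuit M C1" "circuit M C2" and e: "e \<in> C1" "e \<in> C2" and f: "f \<in> C1" "f \<notin> C2"
  obtains C3 where "circuit M C3" "f \<in> C3" "C3 \<subseteq> C1 \<union> C2 - {e}"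
proof -
  let ?X = "C1 \<union> C2 - {e, f}"
  obtain B where B: "basis_of M ?X B"
    using basis_of_exists[OF indep_empty empty_subsetI] by metis
  have "\<not> indep M (insert e B)"
    using basis_of_insert_dependent[OF B C(2) e(2)] f by blast
  then have "basis_of M (insert e ?X) B"
    using B by (auto simp: basis_of_def)
  then have "\<not> indep M (insert f B)"
    using basis_of_insert_dependent[OF _ C(1) f(1)] e f by blast
  moreover have "indep M B" "f \<in> ground M"
    using B C f circuit_subset_ground by (auto simp: basis_of_def)
  ultimately obtain C3 where "circuit M C3" "f \<in> C3" "C3 \<subseteq> insert f B"
    using dependent_insert_circuit by metis
  then show thesis
    using that[of C3] B e f by (auto simp: basis_of_def)
qed

text \<open>Transitivity of lying on a common circuit, by induction on the size of the union.
  Eliminating a common \<open>y\<close> in two ways, once keeping \<open>x\<close> and once keeping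
  \<open>z\<close>, leads to intersecting circuits with a smaller union.\<close>

lemma circuit_through_two_elements:
  assumes "circuit M C1" "circuit M C2" "C1 \<inter> C2 \<noteq> {}" "x \<in> C1" "z \<in> C2"
  shows "\<exists>C. circuit M C \<and> x \<in> C \<and> z \<in> C"
  using assms
proof (induction "card (C1 \<union> C2)" arbitrary: C1 C2 rule: less_induct)
  case less
  note C1 = less.prems(1) and C2 = less.prems(2)
  have fin: "finite (C1 \<union> C2)"
    using C1 C2 circuit_finite by auto
  have smaller: "\<exists>C. circuit M C \<and> x \<in> C \<and> z \<in> C"
    if "D1 \<union> D2 \<subset> C1 \<union> C2" "circuit M D1" "circuit M D2" "D1 \<inter> D2 \<noteq> {}" "x \<in> D1" "z \<in> D2" for D1 D2
    using less.hyps[of D1 D2] that psubset_card_mono[OF fin] by blast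
  show ?case
  proof (rule ccontr)
    assume no: "\<not> ?case"
    obtain y where y: "y \<in> C1" "y \<in> C2"
      using less.prems by blast
    have xz: "x \<notin> C2" "z \<notin> C1"
      using no less.prems by blast+
    obtain C3 where C3: "circuit M C3" "x \<in> C3" "C3 \<subseteq> C1 \<union> C2 - {y}"
      using strong_circuit_elimination[OF C1 C2 y less.prems(4) xz(1)] by blast
    obtain C4 where C4: "circuit M C4" "z \<in> C4" "C4 \<subseteq> C2 \<union> C1 - {y}"
      using strong_circuit_elimination[OF C2 C1 y(2,1) less.prems(5) xz(2)] by blast
    have "\<not> C3 \<subseteq> C1" "\<not> C4 \<subseteq> C2"
      using circuit_subset_eq C1 C2 C3 C4 y by blast+
    then have meet: "C3 \<inter> C2 \<noteq> {}" "C1 \<inter> C4 \<noteq> {}" "C4 \<inter> (C1 - C2) \<noteq> {}"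
      using C3 C4 by blast+
    \<comment> \<open>A smaller union would finish by induction. Hence \<open>C3\<close> contains
      all of \<open>C1 - C2\<close>, a set that \<open>C4\<close> meets.\<close>
    have "\<not> C3 \<union> C2 \<subset> C1 \<union> C2"
      using smaller[of C3 C2] C3 C2 meet less.prems no by blast
    then have "C1 - C2 \<subseteq> C3"
      using C3 by blast
    then have "C3 \<inter> C4 \<noteq> {}"
      using meet by blast
    moreover have "C3 \<union> C4 \<subset> C1 \<union> C2"
      using C3 C4 y by blast
    ultimately show False
      using smaller[of C3 C4] C3 C4 no by blast
  qed
qed

section \<open>Circuits of contractions and restrictions\<close>

lemma circuit_restriction: "circuit (restriction M X) C \<longleftrightarrow> circuit M C \<and> C \<subseteq> X"
  by (auto simp: circuit_def)

text \<open>A circuit of \<open>M\<close> inside \<open>insert e D\<close> cannot miss an element of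
  \<open>D\<close>, since its trace on \<open>D\<close> would then be independent in the
  contraction. If \<open>{e}\<close> is dependent, contraction is deletion and \<open>D\<close>
  itself works.\<close>

lemma circuit_contractE:
  assumes "circuit (contract M e) D"
  obtains C where "circuit M C" "C - {e} = D"
proof (cases "indep M {e}")
  case True
  have D: "D \<subseteq> ground M - {e}" "\<not> indep M (insert e D)"
    using assms True by (auto simp: circuit_def indep_contract)
  have "e \<in> ground M"
    using True indep_subset_ground by blast
  then obtain C where C: "circuit M C" "C \<subseteq> insert e D"
    using D dependent_contains_circuit[of "insert e D" M] by blast
  have "C - {e} = D"
  proof (rule ccontr)
    assume "C - {e} \<noteq> D"
    then have "indep (contract M e) (C - {e})"
      using C(2) by (intro circuit_psubset_indep[OF assms]) blast
    then have "indep M (insert e (C - {e}))"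
      using True by (simp add: indep_contract)
    then have "indep M C"
      by (rule indep_mono) blast
    then show False
      using C(1) circuit_dependent by blast
  qed
  then show thesis
    using that C(1) by blast
next
  case False
  then have "circuit M D" "D - {e} = D"
    using assms by (auto simp: circuit_def indep_contract)
  then show thesis
    using that by blast
qed

lemma circuit_contractI:
  assumes "circuit M C" "e \<in> C" "C \<noteq> {e}"
  shows "circuit (contract M e) (C - {e})"
proof -
  \<comment> \<open>As \<open>C\<close> is not \<open>{e}\<close>, the element \<open>e\<close> is
    no loop, so this contraction is not a mere deletion.\<close>
  have e: "indep M {e}"
    using assms by (intro circuit_psubset_indep[OF assms(1)]) auto
  have "indep M (insert e D)" if "D \<subset> C - {e}" for D
    using that assms(2) by (intro circuit_psubset_indep[OF assms(1)]) auto
  then show ?thesis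
    using assms e by (auto simp: circuit_def indep_contract insert_absorb)
qed

text \<open>If a circuit \<open>C1\<close> of the contraction is a proper part of \<open>C\<close>,
  it lifts to a circuit \<open>D1\<close> through \<open>e\<close>. Eliminating some
  \<open>f\<close> of \<open>C1\<close> between \<open>D1\<close> and \<open>C\<close>, while
  keeping \<open>e\<close>, gives the second part.\<close>

lemma circuit_contract_split:
  assumes C: "circuit M C" "e \<notin> C"
  obtains C1 C2 where "circuit (contract M e) C1" "circuit (contract M e) C2" "C1 \<union> C2 = C"
proof (cases "indep M {e}")
  case False
  then have "circuit (contract M e) C"
    using C by (auto simp: circuit_def indep_contract)
  then show thesis
    using that by blast
next
  case True
  have "C \<subseteq> ground (contract M e)" "\<not> indep (contract M e) C"
    using C True indep_mono[of M "insert e C" C] by (auto simp: circuit_def indep_contract)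
  then obtain C1 where C1: "circuit (contract M e) C1" "C1 \<subseteq> C"
    using dependent_contains_circuit by metis
  show thesis
  proof (cases "C1 = C")
    case True
    then show thesis
      using that C1 by blast
  next
    case False
    obtain D1 where D1: "circuit M D1" "D1 - {e} = C1"
      using C1 circuit_contractE by metis
    have e: "e \<in> D1"
      using circuit_subset_eq[OF D1(1) C(1)] C1 D1 False by blast
    obtain f where f: "f \<in> C1"
      using circuit_nonempty[OF C1(1)] by blast
    then have "f \<in> D1" "f \<in> C"
      using D1 C1 by auto
    then obtain D2 where D2: "circuit M D2" "e \<in> D2" "D2 \<subseteq> D1 \<union> C - {f}"
      using strong_circuit_elimination[OF D1(1) C(1) _ _ e C(2)] by metis
    have "D2 \<noteq> {e}"
      using D2 True circuit_dependent by blast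
    then have C2: "circuit (contract M e) (D2 - {e})"
      using D2 circuit_contractI by metis
    have "C - C1 \<subseteq> D2"
    proof
      fix g assume g: "g \<in> C - C1"
      show "g \<in> D2"
      proof (rule ccontr)
        assume "g \<notin> D2"
        \<comment> \<open>Eliminating \<open>e\<close> between the two lifted circuits would leave a
          circuit inside \<open>C\<close> that misses \<open>g\<close>.\<close>
        obtain D3 where D3: "circuit M D3" "D3 \<subseteq> D1 \<union> D2 - {e}"
          using strong_circuit_elimination[OF D1(1) D2(1) e D2(2) \<open>f \<in> D1\<close>] D2(3) by blast
        have "D3 \<subseteq> C - {g}"
          using D3(2) D2(3) D1(2) C1(2) g \<open>g \<notin> D2\<close> C(2) by blast
        then show False
          using circuit_subset_eq[OF D3(1) C(1)] g by blast
      qed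
    qed
    moreover have "D2 - {e} \<subseteq> C"
      using D2 D1 C1 by blast
    ultimately have "C1 \<union> (D2 - {e}) = C"
      using C1 C(2) by blast
    then show thesis
      using that C1 C2 by blast
  qed
qed

lemma circuit_contract_through:
  assumes "circuit M C" "x \<in> C" "x \<noteq> e"
  obtains C' where "circuit (contract M e) C'" "x \<in> C'" "C' \<subseteq> C - {e}"
proof (cases "e \<in> C")
  case True
  then have "circuit (contract M e) (C - {e})"
    using assms by (intro circuit_contractI) auto
  then show thesis
    using that assms by blast
next
  case False
  then obtain C1 C2 where "circuit (contract M e) C1" "circuit (contract M e) C2" "C1 \<union> C2 = C"
    using circuit_contract_split assms(1) by metis
  then show thesis
    using that assms False by blast
qed

section \<open>Contracting the elements of a list one after another\<close>

lemma circuit_foldl_contractE: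
  assumes "circuit (foldl contract M xs) D"
  obtains C where "circuit M C" "C - set xs = D"
proof -
  have "\<exists>C. circuit M C \<and> C - set xs = D"
    using assms
  proof (induction xs arbitrary: M)
    case (Cons e xs)
    then obtain C where C: "circuit (contract M e) C" "C - set xs = D"
      by auto
    then obtain C' where "circuit M C'" "C' - {e} = C"
      using circuit_contractE by metis
    then show ?case
      using C by auto
  qed auto
  then show thesis
    using that by blast
qed

lemma circuit_foldl_contract_through:
  assumes "circuit M C" "x \<in> C" "x \<notin> set xs"
  shows "\<exists>C'. circuit (foldl contract M xs) C' \<and> x \<in> C' \<and> C' \<subseteq> C - set xs"
  using assms
proof (induction xs arbitrary: M C)
  case (Cons e xs)
  then obtain D where D: "circuit (contract M e) D" "x \<in> D" "D \<subseteq> C - {e}"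
    using circuit_contract_through[of M C x e] by auto
  then obtain C' where "circuit (foldl contract (contract M e) xs) C'" "x \<in> C'" "C' \<subseteq> D - set xs"
    using Cons.IH[OF D(1,2)] Cons.prems by auto
  then show ?case
    using D by auto
qed auto

section \<open>Connected components\<close>

lemma connected_restriction:
  "connected_matroid (restriction M X) \<longleftrightarrow>
     (\<forall>x\<in>ground M \<inter> X. \<forall>y\<in>ground M \<inter> X. x \<noteq> y \<longrightarrow> (\<exists>C. circuit M C \<and> C \<subseteq> X \<and> x \<in> C \<and> y \<in> C))"
  by (auto simp: connected_matroid_def circuit_restriction)

lemma connected_in_component:
  assumes "Y \<subseteq> ground M" "Y \<noteq> {}" "connected_matroid (restriction M Y)"
  obtains X where "X \<in> components_matroid M" "Y \<subseteq> X"
proof -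
  define A where "A = {X. X \<subseteq> ground M \<and> connected_matroid (restriction M X)}"
  have "finite A" "Y \<in> A"
    using assms by (simp_all add: A_def)
  then obtain X where X: "X \<in> A" "Y \<subseteq> X" "\<forall>Z\<in>A. X \<subseteq> Z \<longrightarrow> X = Z"
    using finite_has_maximal2 by metis
  then have "X \<in> components_matroid M"
    using assms(2) unfolding components_matroid_def A_def by blast
  then show thesis
    using that X by blast
qed

lemma circuit_in_component:
  assumes "circuit M C"
  obtains X where "X \<in> components_matroid M" "C \<subseteq> X"
proof -
  have "connected_matroid (restriction M C)"
    using assms by (auto simp: connected_restriction)
  then show thesis
    using connected_in_component[of C M] that assms circuit_nonempty circuit_subset_ground by metis
qed

lemma components_nonempty:
  assumes "ground M \<noteq> {}"
  shows "components_matroid M \<noteq> {}"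
proof -
  obtain x where "x \<in> ground M"
    using assms by blast
  then show ?thesis
    using connected_in_component[of "{x}" M] by (force simp: connected_restriction)
qed

lemma finite_components: "finite (components_matroid M)"
  by (rule finite_subset[of _ "Pow (ground M)"]) (auto simp: components_matroid_def)

text \<open>Unlike being a component, this property survives contraction once \<open>e\<close> is
  removed from \<open>X\<close>, which is what comparing \<open>cd M\<close> with
  \<open>cd (contract M e)\<close> requires.\<close>

definition separator :: "'a matroid \<Rightarrow> 'a set \<Rightarrow> bool" where
  "separator M X \<longleftrightarrow> X \<subseteq> ground M \<and> (\<forall>C. circuit M C \<longrightarrow> C \<subseteq> X \<or> C \<inter> X = {})"

text \<open>If \<open>C\<close> meets \<open>X\<close> in \<open>w\<close>, every element of
  \<open>X \<union> C\<close> shares a circuit with \<open>w\<close> inside that set. By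
  transitivity the set is connected, so maximality of \<open>X\<close> absorbs
  \<open>C\<close>.\<close>

lemma component_separator:
  assumes "X \<in> components_matroid M"
  shows "separator M X"
  unfolding separator_def
proof (intro conjI allI impI)
  have X: "X \<subseteq> ground M" "connected_matroid (restriction M X)"
    and max: "\<And>Y. X \<subseteq> Y \<Longrightarrow> Y \<subseteq> ground M \<Longrightarrow> connected_matroid (restriction M Y) \<Longrightarrow> Y = X"
    using assms by (auto simp: components_matroid_def)
  show "X \<subseteq> ground M"
    by (rule X)
  fix C assume C: "circuit M C"
  show "C \<subseteq> X \<or> C \<inter> X = {}"
  proof (rule disjCI)
    assume "C \<inter> X \<noteq> {}"
    then obtain w where w: "w \<in> C" "w \<in> X"
      by blast
    let ?N = "restriction M (X \<union> C)"
    have through_w: "\<exists>D. circuit ?N D \<and> x \<in> D \<and> w \<in> D" if "x \<in> X \<union> C" for x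
    proof (cases "x \<in> C")
      case True
      then show ?thesis
        using C w by (intro exI[of _ C]) (auto simp: circuit_restriction)
    next
      case False
      then have "x \<in> X" "x \<noteq> w"
        using that w by auto
      then obtain D where "circuit M D" "D \<subseteq> X" "x \<in> D" "w \<in> D"
        using X w unfolding connected_restriction by blast
      then show ?thesis
        by (intro exI[of _ D]) (auto simp: circuit_restriction)
    qed
    have "connected_matroid ?N"
      unfolding connected_matroid_def
    proof (intro ballI impI)
      fix x y assume "x \<in> ground ?N" "y \<in> ground ?N"
      then obtain D1 D2 where D: "circuit ?N D1" "x \<in> D1" "w \<in> D1" "circuit ?N D2" "y \<in> D2" "w \<in> D2"
        using through_w by (metis IntD2 ground_restriction)
      then have "D1 \<inter> D2 \<noteq> {}"
        by blast
      then show "\<exists>D. circuit ?N D \<and> x \<in> D \<and> y \<in> D"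
        using circuit_through_two_elements[OF D(1,4) _ D(2,5)] by blast
    qed
    then have "X \<union> C = X"
      using X C circuit_subset_ground by (intro max) auto
    then show "C \<subseteq> X"
      by blast
  qed
qed

lemma restriction_restriction: "restriction (restriction M X) Y = restriction M (X \<inter> Y)"
  by (rule matroid_eqI) auto

text \<open>A connected set meeting a separator lies inside it, since circuits cannot leave it. So
  maximality inside \<open>X\<close> is already maximality in \<open>M\<close>.\<close>

lemma component_of_separator:
  assumes "separator M X" "Y \<in> components_matroid (restriction M X)"
  shows "Y \<in> components_matroid M"
proof -
  have XE: "X \<subseteq> ground M"
    using assms(1) by (simp add: separator_def)
  have Y: "Y \<subseteq> X" "Y \<noteq> {}" "connected_matroid (restriction M Y)"
    and max: "\<And>Z. Y \<subseteq> Z \<Longrightarrow> Z \<subseteq> X \<Longrightarrow> connected_matroid (restriction M Z) \<Longrightarrow> Z = Y"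
    using assms(2) XE
    by (auto simp: components_matroid_def restriction_restriction Int_absorb1)
  have "Z = Y" if Z: "Y \<subseteq> Z" "Z \<subseteq> ground M" "connected_matroid (restriction M Z)" for Z
  proof (rule max[OF Z(1) _ Z(3)])
    obtain y where y: "y \<in> Y"
      using Y(2) by blast
    show "Z \<subseteq> X"
    proof
      fix z assume z: "z \<in> Z"
      show "z \<in> X"
      proof (cases "z = y")
        case True
        then show ?thesis
          using y Y by blast
      next
        case False
        then obtain C where C: "circuit M C" "z \<in> C" "y \<in> C"
          using Z z y unfolding connected_restriction by blast
        then have "C \<inter> X \<noteq> {}"
          using y Y by blast
        then show ?thesis
          using C assms(1) unfolding separator_def by blast
      qed
    qed
  qed
  then show ?thesis
    using Y XE by (auto simp: components_matroid_def)
qed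

section \<open>Contraction depth under passing to components, separators and contractions\<close>

lemma cd_empty: "ground M = {} \<Longrightarrow> cd M = 0"
  by (simp add: cd.simps)

text \<open>A connected matroid has its ground set as its only component, so the recursion for the
  disconnected case holds there too and later arguments need no case split.\<close>

lemma cd_eq_Max_components:
  assumes "ground M \<noteq> {}"
  shows "cd M = Max ((\<lambda>X. cd (restriction M X)) ` components_matroid M)"
proof (cases "connected_matroid M")
  case True
  have "X = ground M" if "X \<in> components_matroid M" for X
  proof -
    have "X \<subseteq> ground M" "X \<subseteq> ground M \<longrightarrow> ground M \<subseteq> ground M \<longrightarrow>
        connected_matroid (restriction M (ground M)) \<longrightarrow> ground M = X"
      using that unfolding components_matroid_def by blast+
    then show ?thesis
      using True by simp
  qed
  then have "components_matroid M = {ground M}"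
    using components_nonempty[OF assms] by blast
  then show ?thesis
    by simp
next
  case False
  then show ?thesis
    using assms by (subst cd.simps) simp
qed

lemma component_ground_nonempty: "X \<in> components_matroid M \<Longrightarrow> ground M \<noteq> {}"
  by (auto simp: components_matroid_def)

lemma cd_component_le:
  assumes "X \<in> components_matroid M"
  shows "cd (restriction M X) \<le> cd M"
  unfolding cd_eq_Max_components[OF component_ground_nonempty[OF assms]]
  using assms finite_components by (intro Max_ge) auto

lemma cd_component_obtain:
  assumes "ground M \<noteq> {}"
  obtains X where "X \<in> components_matroid M" "cd M = cd (restriction M X)"
proof -
  have "cd M \<in> (\<lambda>X. cd (restriction M X)) ` components_matroid M"
    unfolding cd_eq_Max_components[OF assms]
    using finite_components components_nonempty[OF assms] by (intro Max_in) auto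
  then show thesis
    using that by blast
qed

lemma cd_separator_le:
  assumes "separator M X"
  shows "cd (restriction M X) \<le> cd M"
proof (cases "ground (restriction M X) = {}")
  case True
  then show ?thesis
    by (simp add: cd_empty)
next
  case False
  then obtain Y where Y: "Y \<in> components_matroid (restriction M X)"
    "cd (restriction M X) = cd (restriction (restriction M X) Y)"
    using cd_component_obtain by metis
  have "X \<inter> Y = Y"
    using Y(1) by (auto simp: components_matroid_def)
  then show ?thesis
    using Y cd_component_le[OF component_of_separator[OF assms Y(1)]]
    by (simp add: restriction_restriction)
qed

lemma cd_connected_le:
  assumes "connected_matroid M" "e \<in> ground M"
  shows "cd M \<le> cd (contract M e) + 1"
proof -
  have "cd M = (LEAST k. \<exists>e\<in>ground M. cd (contract M e) + 1 \<le> k)"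
    using assms by (subst cd.simps) auto
  also have "\<dots> \<le> cd (contract M e) + 1"
    using assms by (intro Least_le) auto
  finally show ?thesis .
qed

lemma cd_connected_obtain:
  assumes "connected_matroid M" "ground M \<noteq> {}"
  obtains e where "e \<in> ground M" "cd (contract M e) + 1 \<le> cd M"
proof -
  have "cd M = (LEAST k. \<exists>e\<in>ground M. cd (contract M e) + 1 \<le> k)"
    using assms by (subst cd.simps) auto
  moreover have "\<exists>k. \<exists>e\<in>ground M. cd (contract M e) + 1 \<le> k"
    using assms(2) by blast
  ultimately have "\<exists>e\<in>ground M. cd (contract M e) + 1 \<le> cd M"
    using LeastI_ex[of "\<lambda>k. \<exists>e\<in>ground M. cd (contract M e) + 1 \<le> k"] by simp
  then show thesis
    using that by blast
qed

lemma separator_contract: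
  assumes "separator M X"
  shows "separator (contract M e) (X - {e})"
  unfolding separator_def
proof (intro conjI allI impI)
  show "X - {e} \<subseteq> ground (contract M e)"
    using assms by (auto simp: separator_def)
  fix C assume "circuit (contract M e) C"
  then obtain D where "circuit M D" "D - {e} = C"
    using circuit_contractE by metis
  then show "C \<subseteq> X - {e} \<or> C \<inter> (X - {e}) = {}"
    using assms unfolding separator_def by blast
qed

lemma contract_restriction:
  assumes "e \<in> X"
  shows "contract (restriction M X) e = restriction (contract M e) (X - {e})"
  using assms by (intro matroid_eqI) (auto simp: indep_contract)

text \<open>A dependency between \<open>e\<close> and a subset of \<open>X\<close> would be a
  circuit through \<open>e\<close>; it is disjoint from the separator, so it is \<open>{e}\<close>
  and \<open>e\<close> is a loop.\<close>

lemma restriction_contract_separator: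
  assumes "separator M X" "e \<in> ground M" "e \<notin> X"
  shows "restriction (contract M e) X = restriction M X"
proof (rule matroid_eqI)
  show "ground (restriction (contract M e) X) = ground (restriction M X)"
    using assms by auto
  fix I
  have "indep M (insert e I)" if I: "indep M I" "I \<subseteq> X" and e: "indep M {e}"
  proof (rule ccontr)
    assume "\<not> indep M (insert e I)"
    then obtain C where C: "circuit M C" "e \<in> C" "C \<subseteq> insert e I"
      using I assms(2) dependent_insert_circuit by metis
    then have "C \<inter> X = {}"
      using assms unfolding separator_def by blast
    then have "C = {e}"
      using C I by blast
    then show False
      using C e circuit_dependent by blast
  qed
  then show "indep (restriction (contract M e) X) I \<longleftrightarrow> indep (restriction M X) I"
    using assms by (auto simp: indep_contract separator_def intro: indep_mono[of M "insert e I"])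
qed

text \<open>Carries the defining inequality over to disconnected matroids. Take a component
  \<open>X\<close> of largest depth: contracting \<open>e\<close> acts inside \<open>X\<close> or
  leaves \<open>restriction M X\<close> unchanged, and \<open>X - {e}\<close> is a separator of the
  contraction either way.\<close>

lemma cd_le_cd_contract:
  assumes e: "e \<in> ground M"
  shows "cd M \<le> cd (contract M e) + 1"
proof -
  obtain X where X: "X \<in> components_matroid M" "cd M = cd (restriction M X)"
    using e cd_component_obtain by (metis empty_iff)
  note sep = component_separator[OF X(1)]
  note le = cd_separator_le[OF separator_contract[OF sep, of e]]
  show ?thesis
  proof (cases "e \<in> X")
    case True
    have "cd (restriction M X) \<le> cd (contract (restriction M X) e) + 1"
      using X(1) True e by (intro cd_connected_le) (auto simp: components_matroid_def)
    then show ?thesis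
      using X(2) le contract_restriction[OF True, of M] by simp
  next
    case False
    then show ?thesis
      using X(2) le restriction_contract_separator[OF sep e False] by simp
  qed
qed

lemma cd_le_cd_foldl_contract:
  assumes "distinct xs" "set xs \<subseteq> ground M"
  shows "cd M \<le> length xs + cd (foldl contract M xs)"
  using assms
proof (induction xs arbitrary: M)
  case (Cons e xs)
  have "cd M \<le> cd (contract M e) + 1"
    using Cons.prems by (intro cd_le_cd_contract) auto
  moreover have "cd (contract M e) \<le> length xs + cd (foldl contract (contract M e) xs)"
    using Cons.prems by (intro Cons.IH) auto
  ultimately show ?case
    by simp
qed simp

section \<open>The lower bound\<close>

text \<open>Induction on the size of the ground set: a disconnected matroid passes to the component
  containing \<open>C\<close>, a connected one to the contraction that attains
  \<open>cd M\<close>.\<close>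

lemma card_circuit_le_power_cd:
  assumes "circuit M C"
  shows "card C \<le> 2 ^ cd M"
  using assms
proof (induction "card (ground M)" arbitrary: M C rule: less_induct)
  case less
  note C = less.prems
  have ne: "ground M \<noteq> {}"
    using C circuit_nonempty circuit_subset_ground by blast
  show ?case
  proof (cases "connected_matroid M")
    case False
    obtain X where X: "X \<in> components_matroid M" "C \<subseteq> X"
      using C circuit_in_component by metis
    have "X \<subset> ground M"
      using X(1) False by (auto simp: components_matroid_def)
    then have "card (ground (restriction M X)) < card (ground M)"
      by (simp add: psubset_card_mono Int_absorb1)
    then have "card C \<le> 2 ^ cd (restriction M X)"
      using C X by (intro less.hyps) (auto simp: circuit_restriction)
    also have "\<dots> \<le> 2 ^ cd M"
      using cd_component_le[OF X(1)] by (intro power_increasing) auto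
    finally show ?thesis .
  next
    case True
    then obtain e where e: "e \<in> ground M" "cd (contract M e) + 1 \<le> cd M"
      using cd_connected_obtain ne by metis
    let ?k = "2 ^ cd (contract M e) :: nat"
    have IH: "card D \<le> ?k" if "circuit (contract M e) D" for D
      using that e(1) card_Diff1_less[OF finite_ground, of e M] by (intro less.hyps) simp_all
    have "card C \<le> 2 * ?k"
    proof (cases "e \<in> C")
      case True
      have "card (C - {e}) \<le> ?k"
      \<comment> \<open>For a loop the remainder is empty and hence no circuit, but the bound is
        trivial.\<close>
      proof (cases "C = {e}")
        case False
        then show ?thesis
          using IH circuit_contractI[OF C True] by blast
      qed simp
      then have "card C \<le> ?k + 1"
        using True circuit_finite[OF C] by (simp add: card_Diff_singleton)
      moreover have "1 \<le> ?k"
        by simp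
      ultimately show ?thesis
        by linarith
    next
      case False
      then obtain C1 C2 where "circuit (contract M e) C1" "circuit (contract M e) C2" "C1 \<union> C2 = C"
        using C circuit_contract_split by metis
      then show ?thesis
        using IH[of C1] IH[of C2] card_Un_le[of C1 C2] by simp
    qed
    also have "\<dots> = 2 ^ (cd (contract M e) + 1)"
      by simp
    also have "\<dots> \<le> 2 ^ cd M"
      using e by (intro power_increasing) auto
    finally show ?thesis .
  qed
qed

section \<open>The upper bound\<close>

text \<open>\<open>D'\<close> arises by eliminating some \<open>f\<close> in
  \<open>D \<inter> C\<close> between \<open>D\<close> and \<open>C\<close>. Any further elimination
  that removes an element outside \<open>C \<union> C'\<close> yields, by minimality, a circuit
  missing \<open>C\<close> or \<open>C'\<close>; this forces the shape of \<open>D'\<close>.\<close>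

lemma circuit_exchange:
  assumes C: "circuit M C" "C \<inter> C' = {}"
    and D: "circuit M D" "D \<inter> C \<noteq> {}" "D \<inter> C' \<noteq> {}"
    and Z: "D - (C \<union> C') \<noteq> {}"
    and min: "\<And>D'. circuit M D' \<Longrightarrow> D' \<inter> C \<noteq> {} \<Longrightarrow> D' \<inter> C' \<noteq> {} \<Longrightarrow>
      \<not> D' - (C \<union> C') \<subset> D - (C \<union> C')"
  obtains D' where "circuit M D'" "C - D \<subseteq> D'" "D' - C = D - C" "D' \<inter> C \<noteq> {}"
proof -
  obtain f where f: "f \<in> D" "f \<in> C"
    using D by blast
  obtain b where b: "b \<in> D" "b \<in> C'"
    using D by blast
  obtain z where z: "z \<in> D - (C \<union> C')"
    using Z by blast
  obtain D' where D': "circuit M D'" "b \<in> D'" "D' \<subseteq> D \<union> C - {f}"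
    using strong_circuit_elimination[OF D(1) C(1) f b(1)] b C(2) by blast
  have meets: "D' \<inter> C \<noteq> {}"
  proof
    assume "D' \<inter> C = {}"
    then have "D' \<subseteq> D - {f}"
      using D' by blast
    then show False
      using circuit_subset_eq[OF D'(1) D(1)] f by blast
  qed
  have DZ: "D' - (C \<union> C') = D - (C \<union> C')"
    using min[OF D'(1) meets] D' b by blast
  then have zD': "z \<in> D'"
    using z by blast
  have fD': "f \<notin> D'"
    using D' by blast
  have not_below: "\<not> Y \<subseteq> D - C" if "circuit M Y" for Y
    using circuit_subset_eq[OF that D(1)] f by blast
  \<comment> \<open>Otherwise eliminating an outside element \<open>y\<close> of \<open>Y\<close>
    from \<open>D\<close>, keeping \<open>b\<close>, gives a circuit that meets \<open>C'\<close>,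
    hence avoids \<open>C\<close> and lies properly inside \<open>D\<close>.\<close>
  have only_C: "Y = C" if Y: "circuit M Y" "Y \<subseteq> C \<union> (D - (C \<union> C'))" for Y
  proof (rule ccontr)
    assume "Y \<noteq> C"
    then obtain y where y: "y \<in> Y" "y \<in> D - (C \<union> C')"
      using circuit_subset_eq[OF Y(1) C(1)] Y(2) by blast
    have "b \<notin> Y"
      using Y b C(2) by blast
    then obtain E where E: "circuit M E" "b \<in> E" "E \<subseteq> D \<union> Y - {y}"
      using strong_circuit_elimination[OF D(1) Y(1) _ y(1) b(1)] y by blast
    have "E - (C \<union> C') \<subset> D - (C \<union> C')"
      using E(3) Y(2) y by blast
    then have "E \<inter> C = {}"
      using min[OF E(1)] E(2) b by blast
    then have "E \<subseteq> D - C"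
      using E(3) Y(2) by blast
    then show False
      using not_below E(1) by blast
  qed
  have CD: "C - D \<subseteq> D'"
  proof -
    \<comment> \<open>Keeping \<open>f\<close> makes \<open>E\<close> meet \<open>C\<close>, so
      \<open>E\<close> avoids \<open>C'\<close> and must be \<open>C\<close> itself. Thus
      \<open>D\<close> and \<open>D'\<close> together cover \<open>C\<close>.\<close>
    obtain E where E: "circuit M E" "f \<in> E" "E \<subseteq> D \<union> D' - {z}"
      using strong_circuit_elimination[OF D(1) D'(1) _ zD' f(1) fD'] z by blast
    have "E - (C \<union> C') \<subset> D - (C \<union> C')"
      using E(3) DZ z by blast
    then have "E \<inter> C' = {}"
      using min[OF E(1)] E(2) f by blast
    then have "E \<subseteq> C \<union> (D - (C \<union> C'))"
      using E(3) D'(3) by blast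
    then have "E = C"
      using only_C E(1) by blast
    then show ?thesis
      using E(3) by blast
  qed
  have DC': "D \<inter> C' \<subseteq> D'"
  proof
    fix x assume x: "x \<in> D \<inter> C'"
    show "x \<in> D'"
    proof (rule ccontr)
      assume "x \<notin> D'"
      \<comment> \<open>Keeping \<open>x\<close> makes \<open>E\<close> meet \<open>C'\<close>, so
        \<open>E\<close> avoids \<open>C\<close> and would lie properly inside
        \<open>D\<close>.\<close>
      then obtain E where E: "circuit M E" "x \<in> E" "E \<subseteq> D \<union> D' - {z}"
        using strong_circuit_elimination[OF D(1) D'(1) _ zD', of x] z x by blast
      have "E - (C \<union> C') \<subset> D - (C \<union> C')"
        using E(3) DZ z by blast
      then have "E \<inter> C = {}"
        using min[OF E(1)] E(2) x by blast
      then have "E \<subseteq> D - C"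
        using E(3) D'(3) by blast
      then show False
        using not_below E(1) by blast
    qed
  qed
  have "D' - C = D - C"
    using DC' DZ D'(3) by blast
  then show thesis
    using that D'(1) CD meets by blast
qed

lemma card_circuit_contract_largest_less:
  assumes conn: "connected_matroid M"
    and C: "circuit M C" and largest: "\<And>D. circuit M D \<Longrightarrow> card D \<le> card C"
    and xs: "set xs = C" and C': "circuit (foldl contract M xs) C'"
  shows "card C' < card C"
proof (rule ccontr)
  assume "\<not> card C' < card C"
  then have ge: "card C \<le> card C'"
    by simp
  obtain D0 where D0: "circuit M D0" "D0 - C = C'"
    using C' xs circuit_foldl_contractE by metis
  \<comment> \<open>The lift \<open>D0\<close> has at most \<open>card C\<close> elements, and its
    trace \<open>C'\<close> at least that many. So nothing of \<open>D0\<close> lies in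
    \<open>C\<close>, and \<open>C'\<close> is a circuit of \<open>M\<close>.\<close>
  have "card D0 \<le> card (D0 - C)"
    using largest[OF D0(1)] ge D0(2) by simp
  then have "D0 - C = D0"
    using circuit_finite[OF D0(1)] by (intro card_seteq) auto
  then have cC': "circuit M C'" and disj: "C \<inter> C' = {}"
    using D0 by auto
  have fin: "finite C" "finite C'"
    using C cC' circuit_finite by auto
  define crossing where "crossing D \<longleftrightarrow> circuit M D \<and> D \<inter> C \<noteq> {} \<and> D \<inter> C' \<noteq> {}" for D
  obtain x y where xy: "x \<in> C" "y \<in> C'"
    using circuit_nonempty C cC' by blast
  then have "x \<in> ground M" "y \<in> ground M" "x \<noteq> y"
    using C cC' disj circuit_subset_ground by blast+
  then obtain D1 where "circuit M D1" "x \<in> D1" "y \<in> D1"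
    using conn unfolding connected_matroid_def by blast
  then have "crossing D1"
    using xy by (auto simp: crossing_def)
  then obtain D where D: "crossing D"
    and Dmin: "\<And>D'. crossing D' \<Longrightarrow> card (D - (C \<union> C')) \<le> card (D' - (C \<union> C'))"
    using arg_min_nat_lemma[of crossing D1 "\<lambda>D. card (D - (C \<union> C'))"] by blast
  have cD: "circuit M D" "D \<inter> C \<noteq> {}" "D \<inter> C' \<noteq> {}"
    using D by (auto simp: crossing_def)
  have finD: "finite D"
    using cD circuit_finite by blast
  have min: "\<not> D' - (C \<union> C') \<subset> D - (C \<union> C')"
    if "circuit M D'" "D' \<inter> C \<noteq> {}" "D' \<inter> C' \<noteq> {}" for D'
    using Dmin[of D'] that finD psubset_card_mono[of "D - (C \<union> C')" "D' - (C \<union> C')"]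
    by (auto simp: crossing_def)
  \<comment> \<open>Otherwise an element of \<open>D \<inter> C'\<close> stays on a circuit of the
    contraction inside \<open>D - C\<close>, hence inside \<open>C'\<close>. That circuit is
    \<open>C'\<close>, so \<open>C'\<close> lies in \<open>D\<close> and equals it, although
    \<open>D\<close> meets \<open>C\<close>.\<close>
  have Z: "D - (C \<union> C') \<noteq> {}"
  proof
    assume "D - (C \<union> C') = {}"
    then have sub: "D - C \<subseteq> C'"
      by blast
    obtain w where w: "w \<in> D" "w \<in> C'" "w \<notin> set xs"
      using cD disj xs by blast
    then obtain E where E: "circuit (foldl contract M xs) E" "E \<subseteq> D - C"
      using circuit_foldl_contract_through[OF cD(1), of w xs] xs by blast
    then have "E = C'"
      using circuit_subset_eq[OF E(1) C'] sub by blast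
    then have "C' = D"
      using E circuit_subset_eq[OF cC' cD(1)] by blast
    then show False
      using cD disj by blast
  qed
  obtain D' where D': "circuit M D'" "C - D \<subseteq> D'" "D' - C = D - C" "D' \<inter> C \<noteq> {}"
    using circuit_exchange[OF C disj cD Z min] by blast
  \<comment> \<open>\<open>D'\<close> inherits minimality because its outside part is unchanged, so
    the exchange applies again with \<open>C\<close> and \<open>C'\<close> swapped.\<close>
  have Zeq: "D' - (C' \<union> C) = D - (C \<union> C')"
    using D'(3) by blast
  have "D' \<inter> C' = D \<inter> C'"
    using D'(3) disj by blast
  then obtain D2 where D2: "circuit M D2" "C' - D' \<subseteq> D2" "D2 - C' = D' - C'"
    using circuit_exchange[of M C' C D'] cC' disj D' cD Z min Zeq
    by (metis Int_commute Un_commute)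
  let ?Z = "D - (C \<union> C')"
  have sub: "(C - D) \<union> (C' - D) \<union> ?Z \<subseteq> D2"
    using D2 D' disj by blast
  have "card (C - D) + card (C' - D) + card ?Z = card ((C - D) \<union> (C' - D) \<union> ?Z)"
  proof -
    have "card ((C - D) \<union> (C' - D)) = card (C - D) + card (C' - D)"
      using fin disj by (intro card_Un_disjoint) auto
    moreover have "card ((C - D) \<union> (C' - D) \<union> ?Z) = card ((C - D) \<union> (C' - D)) + card ?Z"
      using fin finD by (intro card_Un_disjoint) auto
    ultimately show ?thesis
      by simp
  qed
  also have "\<dots> \<le> card D2"
    using sub circuit_finite[OF D2(1)] by (intro card_mono)
  also have "\<dots> \<le> card C"
    by (rule largest[OF D2(1)])
  finally have upper2: "card (C - D) + card (C' - D) + card ?Z \<le> card C" .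
  have "card D = card (D \<inter> C) + card (D \<inter> C') + card ?Z"
  proof -
    have "card (D \<inter> (C \<union> C')) = card (D \<inter> C) + card (D \<inter> C')"
      using fin disj by (subst Int_Un_distrib, intro card_Un_disjoint) auto
    moreover have "card D = card (D \<inter> (C \<union> C')) + card ?Z"
      using finD by (simp add: card_Diff_subset_Int card_mono)
    ultimately show ?thesis
      by simp
  qed
  then have upper1: "card (D \<inter> C) + card (D \<inter> C') + card ?Z \<le> card C"
    using largest[OF cD(1)] by simp
  have "card C = card (D \<inter> C) + card (C - D)" "card C' = card (D \<inter> C') + card (C' - D)"
    using fin by (simp_all add: card_Diff_subset_Int card_mono Int_commute)
  moreover have "0 < card ?Z"
    using Z finD by (simp add: card_gt_0_iff)
  \<comment> \<open>Adding the bounds from \<open>D\<close> and \<open>D2\<close> gives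
    \<open>card C + card C' + 2 * card ?Z\<close> at most \<open>2 * card C\<close>, whereas
    \<open>card C'\<close> is at least \<open>card C\<close> and \<open>?Z\<close> is
    nonempty.\<close>
  ultimately show False
    using upper1 upper2 ge by linarith
qed

text \<open>Two distinct elements would share a circuit of size at least 2, so the ground set has at
  most one element.\<close>

lemma cd_connected_small_circuits:
  assumes conn: "connected_matroid M" and small: "\<And>C. circuit M C \<Longrightarrow> card C \<le> 1"
  shows "cd M \<le> 1"
proof (cases "ground M = {}")
  case True
  then show ?thesis
    by (simp add: cd_empty)
next
  case False
  then obtain e where e: "e \<in> ground M"
    by blast
  have "x = e" if "x \<in> ground M" for x
  proof (rule ccontr)
    assume "x \<noteq> e"
    then obtain C where C: "circuit M C" "x \<in> C" "e \<in> C"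
      using conn e \<open>x \<in> ground M\<close> unfolding connected_matroid_def by blast
    then have "card {x, e} \<le> card C"
      using circuit_finite by (intro card_mono) auto
    then show False
      using small[OF C(1)] \<open>x \<noteq> e\<close> by simp
  qed
  then have "cd (contract M e) = 0"
    by (intro cd_empty) auto
  then show ?thesis
    using cd_connected_le[OF conn e] by simp
qed

text \<open>Bounding circuit sizes by \<open>c\<close>, rather than fixing the maximum, lets the
  induction absorb drops of more than one. The effective base case is \<open>Suc 0\<close>, as
  \<open>c = 0\<close> contradicts \<open>1 \<le> c\<close>.\<close>

lemma cd_le_of_circuits:
  fixes M :: "'a matroid"
  assumes "\<And>C. circuit M C \<Longrightarrow> card C \<le> c" "1 \<le> c"
  shows "2 * cd M \<le> c * (c + 1)"
  using assms
proof (induction c arbitrary: M)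
  case 0
  then show ?case
    by simp
next
  case (Suc c)
  have connected_case: "2 * cd N \<le> Suc c * (Suc c + 1)"
    if conn: "connected_matroid N" and N: "\<And>C. circuit N C \<Longrightarrow> card C \<le> Suc c"
    for N :: "'a matroid"
  proof (cases "1 \<le> c \<and> (\<exists>C. circuit N C \<and> card C = Suc c)")
    case True
    then obtain C where C: "circuit N C" "card C = Suc c"
      by blast
    obtain xs where xs: "set xs = C" "distinct xs"
      using finite_distinct_list circuit_finite[OF C(1)] by blast
    have len: "length xs = Suc c"
      using xs C(2) distinct_card by metis
    have "card D \<le> c" if "circuit (foldl contract N xs) D" for D
      using card_circuit_contract_largest_less[OF conn C(1) _ xs(1) that] N C(2) by simp
    \<comment> \<open>Contracting all \<open>Suc c\<close> elements of \<open>C\<close> adds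
      \<open>2 * Suc c\<close> to the doubled depth, exactly the gap between
      \<open>c * (c + 1)\<close> and \<open>Suc c * (Suc c + 1)\<close>.\<close>
    then have "2 * cd (foldl contract N xs) \<le> c * (c + 1)"
      using True by (intro Suc.IH) auto
    moreover have "cd N \<le> length xs + cd (foldl contract N xs)"
      using xs C circuit_subset_ground by (intro cd_le_cd_foldl_contract) auto
    ultimately show ?thesis
      using len by simp
  next
    case False
    show ?thesis
    proof (cases "1 \<le> c")
      case True
      then have "card C \<le> c" if "circuit N C" for C
        using N[OF that] False that by (metis le_Suc_eq)
      then have "2 * cd N \<le> c * (c + 1)"
        using True by (intro Suc.IH) auto
      then show ?thesis
        by simp
    next
      case False
      then have "cd N \<le> 1"
        using N by (intro cd_connected_small_circuits[OF conn]) (force simp: not_less_eq_eq)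
      then show ?thesis
        by simp
    qed
  qed
  show ?case
  proof (cases "ground M = {}")
    case True
    then show ?thesis
      by (simp add: cd_empty)
  next
    case False
    then obtain X where X: "X \<in> components_matroid M" "cd M = cd (restriction M X)"
      using cd_component_obtain by metis
    \<comment> \<open>Some component attains \<open>cd M\<close>, and its circuits are circuits of
      \<open>M\<close>, so they obey the same size bound.\<close>
    then show ?thesis
      using connected_case[of "restriction M X"] Suc.prems(1)
      by (auto simp: components_matroid_def circuit_restriction)
  qed
qed

theorem theorem5p6:
  fixes M :: "'a matroid" and c :: nat
  assumes "c = max_circuit_size M"
  shows "log 2 (real c) \<le> real (cd M) \<and> real (cd M) \<le> real c * (real c + 1) / 2"
proof -
  have c: "1 \<le> c \<and> c \<le> 2 ^ cd M \<and> (\<forall>C. circuit M C \<longrightarrow> card C \<le> c)"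
  proof (cases "\<exists>C. circuit M C")
    case True
    then have cMax: "c = Max (card ` {C. circuit M C})"
      using assms by (simp add: max_circuit_size_def)
    then have "c \<in> card ` {C. circuit M C}"
      using True finite_circuits by (auto intro!: Max_in)
    then obtain C where C: "circuit M C" "c = card C"
      by blast
    then have "1 \<le> c"
      using circuit_nonempty[OF C(1)] circuit_finite[OF C(1)] by (simp add: Suc_le_eq card_gt_0_iff)
    moreover have "card D \<le> c" if "circuit M D" for D
      unfolding cMax using that finite_circuits by (intro Max_ge) auto
    ultimately show ?thesis
      using C card_circuit_le_power_cd[OF C(1)] by blast
  next
    \<comment> \<open>Without circuits the default \<open>c = 1\<close> meets all three claims:
      \<open>1 \<le> 2 ^ cd M\<close> always, and the bound on circuits is vacuous.\<close>
    case False
    then show ?thesis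
      using assms by (simp add: max_circuit_size_def)
  qed
  then have "real c \<le> 2 ^ cd M"
    by (metis of_nat_le_iff of_nat_numeral of_nat_power)
  then have "log 2 (real c) \<le> real (cd M)"
    using c by (simp add: log_le_iff powr_realpow)
  moreover have "real (2 * cd M) \<le> real (c * (c + 1))"
    using c cd_le_of_circuits[of M c] of_nat_le_iff by blast
  ultimately show ?thesis
    by (simp add: algebra_simps)
qed

end
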